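(* Let $k>0$ be real, let $\alpha,\beta,\beta',\gamma\in\mathbb{C}$ with $\gamma\notin\{0,-k,-2k,\dots\}$, and let $x,y\in\mathbb{C}$ with $|x|<\frac1k$, $|y|<\frac1k$. (i) If $\left|\frac{y-x}{1-ky}\right|<\frac1k$, then $$F_{1,k}(\alpha,\beta,\beta';\gamma;x,y)=(1-kx)^{\frac{\gamma-\alpha-\beta}{k}}(1-ky)^{-\frac{\beta'}{k}}F_{1,k}\left(\gamma-\alpha,\gamma-\beta-\beta',\beta';\gamma;x,-\frac{y-x}{1-ky}\right).$$ (ii) If $\left|\frac{y-x}{1-kx}\right|<\frac1k$, then $$F_{1,k}(\alpha,\beta,\beta';\gamma;x,y)=(1-kx)^{-\frac{\beta}{k}}(1-ky)^{\frac{\gamma-\alpha-\beta'}{k}}F_{1,k}\left(\gamma-\alpha,\beta,\gamma-\beta-\beta';\gamma;\frac{y-x}{1-kx},y\right).$$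
   Context: For real $k>0$, $a\in\mathbb{C}$ and an integer $n\ge 1$, the Pochhammer $k$-symbol is $(a)_{n,k}=a(a+k)(a+2k)\cdots(a+(n-1)k)$, and $(a)_{0,k}=1$. The first Appell $k$-function is $$F_{1,k}(\alpha,\beta,\beta';\gamma;x,y)=\sum_{m,n=0}^\infty\frac{(\alpha)_{m+n,k}(\beta)_{m,k}(\beta')_{n,k}}{(\gamma)_{m+n,k}}\frac{x^m}{m!}\frac{y^n}{n!},\qquad |x|<\tfrac1k,\ |y|<\tfrac1k.$$ Complex powers are principal values. *)

theory Defs
  imports "HOL-Analysis.Analysis"
begin

definition pochhammer_k :: "real \<Rightarrow> complex \<Rightarrow> nat \<Rightarrow> complex" where
  "pochhammer_k k a n = (\<Prod>i<n. a + of_nat i * of_real k)"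

text \<open>
  The double series is an unordered sum over all pairs \<open>(m, n)\<close>. It converges
  absolutely if \<open>\<bar>x\<bar>, \<bar>y\<bar> < 1/k\<close> and \<open>\<gamma>\<close> is none of \<open>0, -k, -2k, \<dots>\<close>;
  the definition is only meaningful for such arguments.
\<close>
definition appell_F1_k ::
  "real \<Rightarrow> complex \<Rightarrow> complex \<Rightarrow> complex \<Rightarrow> complex \<Rightarrow> complex \<Rightarrow> complex \<Rightarrow> complex" where
  "appell_F1_k k \<alpha> \<beta> \<beta>' \<gamma> x y =
     (\<Sum>\<^sub>\<infinity>(m, n)\<in>UNIV.
        pochhammer_k k \<alpha> (m + n) * pochhammer_k k \<beta> m * pochhammer_k k \<beta>' n
          / pochhammer_k k \<gamma> (m + n) * (x ^ m / fact m) * (y ^ n / fact n))"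

end

theory Submission
  imports Defs "HOL-Complex_Analysis.Complex_Analysis"
begin

text \<open>
  Replacing every parameter by its quotient by \<open>k\<close> and both variables by their product with
  \<open>k\<close> reduces the statement to \<open>k = 1\<close>, the classical function \<open>F\<^sub>1\<close>. Part (ii) is part (i)
  with the two variables exchanged. Part (i) concerns the variables \<open>x\<close> and
  \<open>t = (x - y) / (1 - y)\<close>; equivalently \<open>y = (x - t) / (1 - t)\<close> and
  \<open>1 - t = (1 - x) / (1 - y)\<close>. It amounts to the equality of
  \<open>L(t) = (1 - t)\<^sup>-\<^sup>b\<^sup>' F\<^sub>1(a, b, b'; c; x, (x - t)/(1 - t))\<close> and
  \<open>R(t) = (1 - x)\<^sup>c\<^sup>-\<^sup>a\<^sup>-\<^sup>b\<^sup>-\<^sup>b\<^sup>' F\<^sub>1(c - a, c - b - b', b'; c; x, t)\<close> for fixed \<open>x\<close>.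

  Differentiating \<open>R\<close> in \<open>t\<close> gives \<open>b' (c - a) / c\<close> times the same function with \<open>b'\<close> and
  \<open>c\<close> raised by one. The function \<open>L\<close> obeys the very same rule: this is the contiguous relation
  \<open>b' F\<^sub>1 - (1 - y) \<partial>F\<^sub>1/\<partial>y = b' (c - a) / c F\<^sub>1(a, b, b' + 1; c + 1; x, y)\<close>, which holds term by
  term in the series (\<open>appell_F1_contiguous\<close>). So all derivatives of \<open>L\<close> and \<open>R\<close> at \<open>t = 0\<close>
  agree as soon as the values there agree for all the shifted parameters. At \<open>t = 0\<close> we have
  \<open>y = x\<close>, both sides are Gauss functions \<open>\<^sub>2F\<^sub>1\<close> (by Vandermonde's convolution on the left), and
  their equality is Euler's transformation. The admissible \<open>t\<close> form the intersection of the unit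
  disc with the half-plane \<open>\<bar>x - t\<bar> < \<bar>1 - t\<bar>\<close>, which is convex, so equality of all derivatives at
  \<open>0\<close> gives \<open>L = R\<close> there (\<open>appell_F1_moebius\<close>).

  Euler's transformation comes out of the same argument. For \<open>x = 0\<close> the values at \<open>t = 0\<close> are
  trivially equal and the conclusion is Pfaff's transformation (\<open>hyp2F1_pfaff\<close>); applying it
  twice near \<open>0\<close> and continuing analytically to the unit disc gives \<open>hyp2F1_euler\<close>.
\<close>

section \<open>The Appell and Gauss series\<close>

definition appell_coeff ::
  "complex \<Rightarrow> complex \<Rightarrow> complex \<Rightarrow> complex \<Rightarrow> nat \<Rightarrow> nat \<Rightarrow> complex" where
  "appell_coeff a b b' c m n =
     pochhammer a (m + n) / pochhammer c (m + n) * (pochhammer b m / fact m) * (pochhammer b' n / fact n)"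

definition appell_F1 ::
  "complex \<Rightarrow> complex \<Rightarrow> complex \<Rightarrow> complex \<Rightarrow> complex \<Rightarrow> complex \<Rightarrow> complex" where
  "appell_F1 a b b' c x y = (\<Sum>\<^sub>\<infinity>(m, n)\<in>UNIV. appell_coeff a b b' c m n * x ^ m * y ^ n)"

definition hyp2F1 :: "complex \<Rightarrow> complex \<Rightarrow> complex \<Rightarrow> complex \<Rightarrow> complex" where
  "hyp2F1 a b c z = (\<Sum>\<^sub>\<infinity>n. pochhammer a n / pochhammer c n * (pochhammer b n / fact n) * z ^ n)"

lemma appell_F1_k_eq_appell_F1:
  assumes "k > 0"
  shows "appell_F1_k k \<alpha> \<beta> \<beta>' \<gamma> x y =
    appell_F1 (\<alpha> / k) (\<beta> / k) (\<beta>' / k) (\<gamma> / k) (k * x) (k * y)"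
proof -
  have *: "pochhammer_k k a n = of_real k ^ n * pochhammer (a / k) n" for a n
    using assms unfolding pochhammer_k_def
    by (induction n) (auto simp: pochhammer_Suc field_simps)
  have nz: "complex_of_real k \<noteq> 0" using assms by simp
  show ?thesis
    unfolding appell_F1_k_def appell_F1_def appell_coeff_def *
    by (intro infsum_cong) (use nz in \<open>auto simp: power_add power_mult_distrib field_simps\<close>)
qed

section \<open>Absolute convergence\<close>

lemma notin_nonpos_Ints_add_of_nat:
  "c \<notin> \<int>\<^sub>\<le>\<^sub>0 \<Longrightarrow> c + of_nat q \<notin> (\<int>\<^sub>\<le>\<^sub>0 :: complex set)"
  by (metis add_diff_cancel_right' nonpos_Ints_diff_Nats of_nat_in_Nats)

lemma pochhammer_neq_0: "c \<notin> \<int>\<^sub>\<le>\<^sub>0 \<Longrightarrow> pochhammer (c::complex) n \<noteq> 0"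
  using pochhammer_eq_0_imp_nonpos_Int by blast

text \<open>
  The factors that lead from one term of \<open>s n / R ^ n\<close> to the next tend to \<open>1 / R < 1\<close>, so this
  sequence is summable and hence bounded. Stating the hypothesis by a recurrence rather than by
  quotients of terms covers sequences that end in zeros, such as \<open>pochhammer (-1)\<close>.
\<close>
lemma geometric_bound_of_ratio_tendsto_1:
  fixes s r :: "nat \<Rightarrow> complex"
  assumes s: "\<And>n. s (Suc n) = r n * s n" and r: "r \<longlonglongrightarrow> 1" and R: "R > 1"
  obtains K where "K \<ge> 0" "\<And>n. norm (s n) \<le> K * R ^ n"
proof -
  have "eventually (\<lambda>n. norm (r n) < sqrt R) sequentially"
    using tendsto_norm[OF r] R by (intro order_tendstoD(2)) auto
  then obtain N where N: "\<And>n. n \<ge> N \<Longrightarrow> norm (r n) < sqrt R"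
    by (auto simp: eventually_sequentially)
  have "summable (\<lambda>n. s n / of_real R ^ n)"
  proof (rule summable_ratio_test[where c = "1 / sqrt R" and N = N])
    fix n assume "n \<ge> N"
    from N[OF this] have "norm (r n) * sqrt R \<le> R"
      using R by (metis abs_of_nonneg less_eq_real_def mult_right_mono order_trans
            real_sqrt_ge_zero real_sqrt_mult_self zero_le_one)
    then have "norm (r n) / R \<le> 1 / sqrt R"
      using R by (simp add: field_simps)
    then have "norm (r n) / R * (norm (s n) / R ^ n) \<le> 1 / sqrt R * (norm (s n) / R ^ n)"
      using R by (intro mult_right_mono) auto
    then show "norm (s (Suc n) / of_real R ^ Suc n) \<le> 1 / sqrt R * norm (s n / of_real R ^ n)"
      using R by (simp add: s norm_mult norm_divide norm_power)
  qed (use R in auto)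
  then have "Bseq (\<lambda>n. s n / of_real R ^ n)"
    using summable_LIMSEQ_zero convergent_imp_Bseq convergentI by blast
  then obtain K where "K > 0" "\<And>n. norm (s n / of_real R ^ n) \<le> K"
    unfolding Bseq_def by blast
  then show ?thesis
    using R by (intro that[of K]) (auto simp: norm_divide norm_power field_simps)
qed

lemma affine_ratio_tendsto_1:
  "(\<lambda>n. (a + of_nat n) / (c + of_nat n)) \<longlonglongrightarrow> (1::complex)"
proof -
  have inf: "filterlim (\<lambda>n. c + of_nat n) at_infinity sequentially"
    by (intro tendsto_add_filterlim_at_infinity[OF tendsto_const] tendsto_of_nat)
  have "(\<lambda>n. 1 + (a - c) / (c + of_nat n)) \<longlonglongrightarrow> 1 + 0"
    by (intro tendsto_add tendsto_const tendsto_divide_0[OF tendsto_const] inf)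
  moreover have "eventually (\<lambda>n. c + of_nat n \<noteq> 0) sequentially"
    using inf by (rule filterlim_at_infinity_imp_eventually_ne)
  then have "eventually (\<lambda>n. 1 + (a - c) / (c + of_nat n) = (a + of_nat n) / (c + of_nat n)) sequentially"
    by eventually_elim (auto simp: divide_simps)
  ultimately show ?thesis
    using tendsto_cong by fastforce
qed

lemma pochhammer_quotient_bound:
  assumes "c \<notin> \<int>\<^sub>\<le>\<^sub>0" "R > 1"
  obtains K where "K \<ge> 0" "\<And>n. norm (pochhammer a n / pochhammer c n :: complex) \<le> K * R ^ n"
proof (rule geometric_bound_of_ratio_tendsto_1[OF _ affine_ratio_tendsto_1 \<open>R > 1\<close>,
        where s = "\<lambda>n. pochhammer a n / pochhammer c n"])
  show "pochhammer a (Suc n) / pochhammer c (Suc n) =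
    (a + of_nat n) / (c + of_nat n) * (pochhammer a n / pochhammer c n)" for n
    by (simp add: pochhammer_Suc mult_ac)
qed (use that in blast)

text \<open>
  For every \<open>R > 1\<close> each of the three factors of the coefficient is dominated by a multiple of a
  power of \<open>R\<close>, so for \<open>R\<close> close to \<open>1\<close> the double series is dominated by a product of two
  geometric series.
\<close>
lemma appell_abs_summable:
  assumes c: "c \<notin> \<int>\<^sub>\<le>\<^sub>0" and x: "norm x < 1" and y: "norm y < 1"
  shows "(\<lambda>p. norm (case p of (m, n) \<Rightarrow> appell_coeff a b b' c m n * x ^ m * y ^ n)) summable_on UNIV"
proof -
  define \<rho> where "\<rho> = max (norm x) (norm y)"
  have \<rho>: "0 \<le> \<rho>" "\<rho> < 1" using x y by (auto simp: \<rho>_def le_max_iff_disj)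
  \<comment> \<open>The coefficient at \<open>(m, n)\<close> is bounded by a multiple of \<open>R ^ (m + n) * R ^ m * R ^ n\<close>, so the
      ratio of the dominating geometric series is \<open>R\<^sup>2 * \<rho>\<close>.\<close>
  obtain R where R: "R > 1" "R\<^sup>2 * \<rho> < 1"
  proof (cases "\<rho> = 0")
    case False
    have "sqrt (2 / (1 + \<rho>)) > 1" using \<rho> by simp
    moreover have "(sqrt (2 / (1 + \<rho>)))\<^sup>2 * \<rho> < 1" using \<rho> by (simp add: field_simps)
    ultimately show ?thesis using that by blast
  qed (use that[of 2] in auto)
  obtain A where A: "A \<ge> 0" "\<And>n. norm (pochhammer a n / pochhammer c n) \<le> A * R ^ n"
    using pochhammer_quotient_bound[OF c R(1)] by blast
  have one: "(1::complex) \<notin> \<int>\<^sub>\<le>\<^sub>0" by simp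
  obtain B where B: "B \<ge> 0" "\<And>n. norm (pochhammer b n / fact n) \<le> B * R ^ n"
    using pochhammer_quotient_bound[OF one R(1)] by (metis pochhammer_fact)
  obtain B' where B': "B' \<ge> 0" "\<And>n. norm (pochhammer b' n / fact n) \<le> B' * R ^ n"
    using pochhammer_quotient_bound[OF one R(1)] by (metis pochhammer_fact)
  define q where "q = R\<^sup>2 * \<rho>"
  have q: "0 \<le> q" "q < 1" using R \<rho> by (auto simp: q_def)
  have geo: "(\<lambda>n::nat. norm (q ^ n)) summable_on UNIV"
    using q by (subst summable_on_UNIV_nonneg_real_iff) (auto intro: summable_geometric)
  have "(\<lambda>p. norm (q ^ fst p * q ^ snd p)) summable_on (UNIV \<times> UNIV :: (nat \<times> nat) set)"
    using geo q(1) unfolding Infinite_Sum.abs_summable_on_Sigma_iff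
    by (auto simp: norm_mult abs_mult infsum_cmult_right' intro!: summable_on_cmult_right summable_on_cmult_left)
  then have "(\<lambda>p. norm ((A * B * B') * (q ^ fst p * q ^ snd p))) summable_on (UNIV :: (nat \<times> nat) set)"
    unfolding norm_mult[of "A * B * B'"] by (intro summable_on_cmult_right) simp
  then show ?thesis
  proof (rule Infinite_Sum.abs_summable_on_comparison_test)
    fix p :: "nat \<times> nat"
    obtain m n where p: "p = (m, n)" by fastforce
    have "norm (appell_coeff a b b' c m n * x ^ m * y ^ n) =
      norm (pochhammer a (m + n) / pochhammer c (m + n)) * norm (pochhammer b m / fact m)
        * norm (pochhammer b' n / fact n) * norm x ^ m * norm y ^ n"
      unfolding appell_coeff_def by (simp only: norm_mult norm_power)
    also have "\<dots> \<le> (A * R ^ (m + n)) * (B * R ^ m) * (B' * R ^ n) * \<rho> ^ m * \<rho> ^ n"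
      using A B B' R \<rho> by (intro mult_mono power_mono) (auto simp: \<rho>_def)
    also have "\<dots> = A * B * B' * (q ^ m * q ^ n)"
      by (simp add: q_def power_mult_distrib power_add power2_eq_square)
    finally show "norm (case p of (m, n) \<Rightarrow> appell_coeff a b b' c m n * x ^ m * y ^ n)
        \<le> norm ((A * B * B') * (q ^ fst p * q ^ snd p))"
      using A B B' q by (simp add: p abs_mult)
  qed
qed

lemmas appell_summable = abs_summable_summable[OF appell_abs_summable]

lemma appell_coeff_commute: "appell_coeff a b b' c m n = appell_coeff a b' b c n m"
  by (simp add: appell_coeff_def add.commute mult_ac)

section \<open>The Appell function as a power series in its second variable\<close>

lemma appell_F1_commute: "appell_F1 a b b' c x y = appell_F1 a b' b c y x"
proof -
  have "bij_betw prod.swap (UNIV :: (nat \<times> nat) set) UNIV"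
    by (rule bij_betw_byWitness[where f' = prod.swap]) auto
  then show ?thesis
    unfolding appell_F1_def
    by (subst infsum_reindex_bij_betw[symmetric, where g = prod.swap])
       (auto intro!: infsum_cong simp: appell_coeff_commute[of a b] case_prod_unfold)
qed

text \<open>
The coefficient of \<open>y ^ n\<close> in \<open>F\<^sub>1\<close> for fixed \<open>x\<close>.
\<close>
definition appell_col :: "complex \<Rightarrow> complex \<Rightarrow> complex \<Rightarrow> complex \<Rightarrow> complex \<Rightarrow> nat \<Rightarrow> complex" where
  "appell_col a b b' c x n = (\<Sum>\<^sub>\<infinity>m. appell_coeff a b b' c m n * x ^ m)"

lemma appell_col_summable:
  assumes "c \<notin> \<int>\<^sub>\<le>\<^sub>0" "norm x < 1"
  shows "(\<lambda>m. appell_coeff a b b' c m n * x ^ m) summable_on UNIV"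
proof -
  have "(\<lambda>(m, n). appell_coeff a b b' c m n * x ^ m * (1/2) ^ n) summable_on UNIV \<times> UNIV"
    using appell_summable[OF assms, of "1/2"] by simp
  then have "(\<lambda>(n, m). appell_coeff a b b' c m n * x ^ m * (1/2) ^ n) summable_on UNIV \<times> UNIV"
    by (subst (asm) summable_on_swap) simp
  then have "(\<lambda>m. appell_coeff a b b' c m n * x ^ m * (1/2) ^ n) summable_on UNIV"
    using summable_on_SigmaD1[of "\<lambda>n m. appell_coeff a b b' c m n * x ^ m * (1/2) ^ n" UNIV "\<lambda>_. UNIV" n]
    by simp
  then show ?thesis
    using summable_on_cmult_left'[of "(1/2)^n" "\<lambda>m. appell_coeff a b b' c m n * x ^ m"] by simp
qed

lemma appell_F1_sums:
  assumes c: "c \<notin> \<int>\<^sub>\<le>\<^sub>0" and x: "norm x < 1" and y: "norm y < 1"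
  shows "(\<lambda>n. appell_col a b b' c x n * y ^ n) sums appell_F1 a b b' c x y"
proof (rule has_sum_imp_sums)
  let ?f = "\<lambda>n m. appell_coeff a b' b c n m * y ^ n * x ^ m"
  have s: "(\<lambda>(n, m). ?f n m) summable_on UNIV \<times> UNIV"
    using appell_summable[OF c y x] by simp
  have "appell_F1 a b b' c x y = (\<Sum>\<^sub>\<infinity>n. infsum (?f n) UNIV)"
    unfolding appell_F1_commute[of a b] using infsum_Sigma'_banach[OF s] by (simp add: appell_F1_def)
  moreover have "((\<lambda>n. infsum (?f n) UNIV) has_sum (\<Sum>\<^sub>\<infinity>n. infsum (?f n) UNIV)) UNIV"
    using summable_on_Sigma_banach[OF s] by (rule has_sum_infsum)
  moreover have "infsum (?f n) UNIV = appell_col a b b' c x n * y ^ n" for n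
    unfolding appell_col_def
    by (subst infsum_cmult_left'[symmetric]) (auto intro!: infsum_cong simp: appell_coeff_commute[of a b])
  ultimately show "((\<lambda>n. appell_col a b b' c x n * y ^ n) has_sum appell_F1 a b b' c x y) UNIV"
    by simp
qed

section \<open>Differentiation and a contiguous relation\<close>

lemma appell_coeff_Suc:
  "of_nat (Suc n) * appell_coeff a b b' c m (Suc n) =
     a * b' / c * appell_coeff (a + 1) b (b' + 1) (c + 1) m n"
  by (simp add: appell_coeff_def pochhammer_rec mult_ac del: of_nat_Suc)

lemma pochhammer_quotient_diff:
  fixes a c :: complex
  assumes "c \<notin> \<int>\<^sub>\<le>\<^sub>0"
  shows "pochhammer a j / pochhammer c j - pochhammer a (Suc j) / pochhammer c (Suc j)
    = (c - a) / c * (pochhammer a j / pochhammer (c + 1) j)"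
proof -
  have nz: "pochhammer c j \<noteq> 0" "pochhammer c (Suc j) \<noteq> 0"
    using pochhammer_neq_0[OF assms] by auto
  then have "c + of_nat j \<noteq> 0" by (auto simp: pochhammer_Suc)
  then have "pochhammer a j / pochhammer c j - pochhammer a (Suc j) / pochhammer c (Suc j)
     = (c - a) * pochhammer a j / pochhammer c (Suc j)"
    using nz(1) by (simp add: pochhammer_Suc divide_simps) (simp add: algebra_simps)
  then show ?thesis by (simp add: pochhammer_rec)
qed

text \<open>
  Both terms on the left contain \<open>(b' + n) (b')\<^sub>n = b' (b' + 1)\<^sub>n\<close>; after factoring it out only the
  difference of two consecutive quotients \<open>(a)\<^sub>j / (c)\<^sub>j\<close> with \<open>j = m + n\<close> remains, and that
  difference is \<open>pochhammer_quotient_diff\<close>.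
\<close>
lemma appell_coeff_contiguous:
  assumes "c \<notin> \<int>\<^sub>\<le>\<^sub>0"
  shows "(b' + of_nat n) * appell_coeff a b b' c m n - of_nat (Suc n) * appell_coeff a b b' c m (Suc n)
    = b' * (c - a) / c * appell_coeff a b (b' + 1) (c + 1) m n"
proof -
  let ?q = "\<lambda>j. pochhammer a j / pochhammer c j"
  have shift: "(b' + of_nat n) * pochhammer b' n = b' * pochhammer (b' + 1) n"
    by (metis pochhammer_rec pochhammer_rec')
  have "(b' + of_nat n) * appell_coeff a b b' c m n =
    ?q (m + n) * (pochhammer b m / fact m) * ((b' + of_nat n) * pochhammer b' n / fact n)"
    by (simp add: appell_coeff_def)
  moreover have "of_nat (Suc n) * appell_coeff a b b' c m (Suc n) =
    ?q (Suc (m + n)) * (pochhammer b m / fact m) * (b' * pochhammer (b' + 1) n / fact n)"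
    by (simp add: appell_coeff_def pochhammer_rec[of b'] mult_ac del: of_nat_Suc)
  ultimately have "(b' + of_nat n) * appell_coeff a b b' c m n - of_nat (Suc n) * appell_coeff a b b' c m (Suc n)
    = (?q (m + n) - ?q (Suc (m + n))) * (pochhammer b m / fact m) * (b' * pochhammer (b' + 1) n / fact n)"
    by (simp only: shift left_diff_distrib)
  also have "\<dots> = b' * (c - a) / c * appell_coeff a b (b' + 1) (c + 1) m n"
    unfolding pochhammer_quotient_diff[OF assms] by (simp add: appell_coeff_def mult_ac)
  finally show ?thesis .
qed

lemma appell_col_Suc:
  "of_nat (Suc n) * appell_col a b b' c x (Suc n) =
     a * b' / c * appell_col (a + 1) b (b' + 1) (c + 1) x n"
proof -
  have "of_nat (Suc n) * appell_col a b b' c x (Suc n) =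
    (\<Sum>\<^sub>\<infinity>m. (of_nat (Suc n) * appell_coeff a b b' c m (Suc n)) * x ^ m)"
    unfolding appell_col_def mult.assoc by (rule infsum_cmult_right'[symmetric])
  also have "\<dots> = a * b' / c * appell_col (a + 1) b (b' + 1) (c + 1) x n"
    unfolding appell_col_def appell_coeff_Suc mult.assoc by (rule infsum_cmult_right')
  finally show ?thesis .
qed

lemma appell_col_contiguous:
  assumes c: "c \<notin> \<int>\<^sub>\<le>\<^sub>0" and x: "norm x < 1"
  shows "(b' + of_nat n) * appell_col a b b' c x n - of_nat (Suc n) * appell_col a b b' c x (Suc n)
    = b' * (c - a) / c * appell_col a b (b' + 1) (c + 1) x n"
proof -
  have c': "c + 1 \<notin> \<int>\<^sub>\<le>\<^sub>0" using notin_nonpos_Ints_add_of_nat[OF c, of 1] by simp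
  let ?A = "\<lambda>m. appell_coeff a b b' c m n * x ^ m"
  let ?B = "\<lambda>m. appell_coeff a b b' c m (Suc n) * x ^ m"
  let ?C = "\<lambda>m. appell_coeff a b (b' + 1) (c + 1) m n * x ^ m"
  have *: "(b' + of_nat n) * ?A m = of_nat (Suc n) * ?B m + b' * (c - a) / c * ?C m" for m
    using appell_coeff_contiguous[OF c, of b' n a b m]
    by (simp add: diff_eq_eq mult.assoc[symmetric] add.commute ring_distribs(2) del: of_nat_Suc)
  have "(b' + of_nat n) * infsum ?A UNIV = (\<Sum>\<^sub>\<infinity>m. of_nat (Suc n) * ?B m + b' * (c - a) / c * ?C m)"
    unfolding *[symmetric] by (rule infsum_cmult_right'[symmetric])
  also have "\<dots> = (\<Sum>\<^sub>\<infinity>m. of_nat (Suc n) * ?B m) + (\<Sum>\<^sub>\<infinity>m. b' * (c - a) / c * ?C m)"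
    by (intro infsum_add summable_on_cmult_right appell_col_summable c c' x)
  also have "\<dots> = of_nat (Suc n) * infsum ?B UNIV + b' * (c - a) / c * infsum ?C UNIV"
    by (simp only: infsum_cmult_right')
  finally show ?thesis by (simp add: appell_col_def del: of_nat_Suc)
qed

lemma appell_F1_has_field_derivative:
  assumes c: "c \<notin> \<int>\<^sub>\<le>\<^sub>0" and x: "norm x < 1" and y: "norm y < 1"
  shows "(appell_F1 a b b' c x has_field_derivative
           a * b' / c * appell_F1 (a + 1) b (b' + 1) (c + 1) x y) (at y)"
proof -
  have c': "c + 1 \<notin> \<int>\<^sub>\<le>\<^sub>0" using notin_nonpos_Ints_add_of_nat[OF c, of 1] by simp
  have "((\<lambda>z. \<Sum>n. appell_col a b b' c x n * z ^ n) has_field_derivative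
      (\<Sum>n. diffs (appell_col a b b' c x) n * y ^ n)) (at y)"
    using appell_F1_sums[OF c x] y by (intro termdiffs_strong'[where K = 1]) (auto simp: sums_iff)
  also have "(\<Sum>n. diffs (appell_col a b b' c x) n * y ^ n) =
      (\<Sum>n. a * b' / c * (appell_col (a + 1) b (b' + 1) (c + 1) x n * y ^ n))"
    unfolding diffs_def appell_col_Suc by (simp add: mult.assoc)
  also have "\<dots> = a * b' / c * appell_F1 (a + 1) b (b' + 1) (c + 1) x y"
    using appell_F1_sums[OF c' x y] by (intro sums_unique[symmetric] sums_mult)
  finally show ?thesis
  proof (rule has_field_derivative_transform_within_open[where S = "ball 0 1"])
    fix z :: complex assume "z \<in> ball 0 1"
    then show "(\<Sum>n. appell_col a b b' c x n * z ^ n) = appell_F1 a b b' c x z"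
      using appell_F1_sums[OF c x, of z] by (simp add: sums_iff)
  qed (use y in auto)
qed

text \<open>
  The bracket multiplying \<open>1 - y\<close> is the derivative of \<open>F\<^sub>1\<close> in \<open>y\<close>. In the variable \<open>u\<close> of
  Euler's integral for \<open>F\<^sub>1\<close> the relation says that
  \<open>(1 - u y) - u (1 - y) = 1 - u\<close>, and the weight \<open>1 - u\<close> raises \<open>c\<close>.
\<close>
lemma appell_F1_contiguous:
  assumes c: "c \<notin> \<int>\<^sub>\<le>\<^sub>0" and x: "norm x < 1" and y: "norm y < 1"
  shows "b' * appell_F1 a b b' c x y
      - (1 - y) * (a * b' / c * appell_F1 (a + 1) b (b' + 1) (c + 1) x y)
    = b' * (c - a) / c * appell_F1 a b (b' + 1) (c + 1) x y"
proof -
  have c': "c + 1 \<notin> \<int>\<^sub>\<le>\<^sub>0" using notin_nonpos_Ints_add_of_nat[OF c, of 1] by simp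
  define D where "D = a * b' / c * appell_F1 (a + 1) b (b' + 1) (c + 1) x y"
  let ?C = "appell_col a b b' c x"
  have D: "(\<lambda>n. of_nat (Suc n) * ?C (Suc n) * y ^ n) sums D"
    using sums_mult[OF appell_F1_sums[OF c' x y], of "a * b' / c"]
    by (simp add: D_def appell_col_Suc mult.assoc del: of_nat_Suc)
  from sums_mult[OF this, of y] have "(\<lambda>n. of_nat (Suc n) * ?C (Suc n) * y ^ Suc n) sums (y * D)"
    by (simp add: mult_ac del: of_nat_Suc)
  then have "(\<lambda>n. of_nat n * ?C n * y ^ n) sums (y * D)"
    using sums_Suc[where f = "\<lambda>n. of_nat n * ?C n * y ^ n"] by fastforce
  from sums_diff[OF sums_add[OF sums_mult[OF appell_F1_sums[OF c x y], of b'] this] D]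
  have "(\<lambda>n. ((b' + of_nat n) * ?C n - of_nat (Suc n) * ?C (Suc n)) * y ^ n) sums
      (b' * appell_F1 a b b' c x y + y * D - D)"
    by (simp add: ring_distribs mult.assoc)
  moreover have "(\<lambda>n. ((b' + of_nat n) * ?C n - of_nat (Suc n) * ?C (Suc n)) * y ^ n) sums
      (b' * (c - a) / c * appell_F1 a b (b' + 1) (c + 1) x y)"
    unfolding appell_col_contiguous[OF c x] mult.assoc[of "b' * (c - a) / c"]
    by (intro sums_mult appell_F1_sums c' x y)
  ultimately have "b' * appell_F1 a b b' c x y + y * D - D = b' * (c - a) / c * appell_F1 a b (b' + 1) (c + 1) x y"
    by (rule sums_unique2)
  then show ?thesis unfolding D_def[symmetric] by (simp add: algebra_simps)
qed


section \<open>Reduction to Gauss functions on the axes and on the diagonal\<close>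

lemma hyp2F1_commute: "hyp2F1 a b c z = hyp2F1 b a c z"
  by (simp add: hyp2F1_def mult_ac)

lemma hyp2F1_0 [simp]: "hyp2F1 a b c 0 = 1"
proof -
  have "hyp2F1 a b c 0 = (\<Sum>\<^sub>\<infinity>n\<in>{0}. pochhammer a n / pochhammer c n * (pochhammer b n / fact n) * 0 ^ n)"
    unfolding hyp2F1_def by (intro infsum_cong_neutral) auto
  then show ?thesis by simp
qed

lemma appell_F1_y_0:
  assumes "c \<notin> \<int>\<^sub>\<le>\<^sub>0" "norm x < 1"
  shows "appell_F1 a b b' c x 0 = hyp2F1 a b c x"
proof -
  have "appell_F1 a b b' c x 0 = appell_col a b b' c x 0"
    using appell_F1_sums[OF assms, of 0 a b b'] powser_sums_zero_iff by fastforce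
  then show ?thesis by (simp add: appell_col_def hyp2F1_def appell_coeff_def)
qed

lemma appell_F1_x_0:
  "c \<notin> \<int>\<^sub>\<le>\<^sub>0 \<Longrightarrow> norm y < 1 \<Longrightarrow> appell_F1 a b b' c 0 y = hyp2F1 a b' c y"
  using appell_F1_commute appell_F1_y_0 by metis

text \<open>
  For \<open>y = x\<close> the terms with \<open>m + n = j\<close> share the quotient \<open>(a)\<^sub>j / (c)\<^sub>j\<close>, and the sum of the
  remaining factors is Vandermonde's convolution for \<open>(b + b')\<^sub>j\<close>.
\<close>
lemma appell_F1_diagonal:
  assumes c: "c \<notin> \<int>\<^sub>\<le>\<^sub>0" and x: "norm x < 1"
  shows "appell_F1 a b b' c x x = hyp2F1 a (b + b') c x"
proof -
  let ?f = "\<lambda>(m, n). appell_coeff a b b' c m n * x ^ m * x ^ n"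
  let ?h = "\<lambda>(j, m). (m, j - m :: nat)"
  let ?S = "SIGMA j:UNIV. {..j}"
  have bij: "bij_betw ?h ?S (UNIV :: (nat \<times> nat) set)"
    by (rule bij_betw_byWitness[where f' = "\<lambda>(m, n). (m + n, m)"]) auto
  have "(\<lambda>p. ?f (?h p)) summable_on ?S"
    using appell_summable[OF c x x] by (subst summable_on_reindex_bij_betw[OF bij])
  then have s: "(\<lambda>(j, m). appell_coeff a b b' c m (j - m) * x ^ m * x ^ (j - m)) summable_on ?S"
    by (simp add: case_prod_unfold)
  have "appell_F1 a b b' c x x = infsum (\<lambda>p. ?f (?h p)) ?S"
    unfolding appell_F1_def by (rule infsum_reindex_bij_betw[OF bij, symmetric])
  also have "\<dots> = infsum (\<lambda>(j, m). appell_coeff a b b' c m (j - m) * x ^ m * x ^ (j - m)) ?S"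
    by (simp add: case_prod_unfold)
  also have "\<dots> = (\<Sum>\<^sub>\<infinity>j. \<Sum>\<^sub>\<infinity>m\<in>{..j}. appell_coeff a b b' c m (j - m) * x ^ m * x ^ (j - m))"
    using infsum_Sigma'_banach[OF s] by simp
  also have "\<dots> = hyp2F1 a (b + b') c x"
    unfolding hyp2F1_def
  proof (rule infsum_cong)
    fix j
    have "(\<Sum>m\<le>j. appell_coeff a b b' c m (j - m) * x ^ m * x ^ (j - m)) =
      (\<Sum>m\<le>j. pochhammer a j / pochhammer c j * x ^ j / fact j *
        (of_nat (j choose m) * pochhammer b m * pochhammer b' (j - m)))"
      by (intro sum.cong) (auto simp: appell_coeff_def binomial_fact field_simps power_add[symmetric])
    also have "\<dots> = pochhammer a j / pochhammer c j * (pochhammer (b + b') j / fact j) * x ^ j"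
      by (simp only: sum_distrib_left[symmetric] pochhammer_binomial_sum[symmetric]) simp
    finally show "(\<Sum>\<^sub>\<infinity>m\<in>{..j}. appell_coeff a b b' c m (j - m) * x ^ m * x ^ (j - m)) =
        pochhammer a j / pochhammer c j * (pochhammer (b + b') j / fact j) * x ^ j"
      by simp
  qed
  finally show ?thesis .
qed

section \<open>The transformation in the second variable\<close>

text \<open>
  Every derivative of \<open>D 0\<close> is a constant multiple of some \<open>D q\<close>, so all of them vanish at \<open>z0\<close>.
\<close>
lemma holomorphic_vanishes_of_derivative_chain:
  fixes D :: "nat \<Rightarrow> complex \<Rightarrow> complex" and r :: "nat \<Rightarrow> complex"
  assumes S: "open S" "connected S" "z0 \<in> S" "t \<in> S"
    and deriv: "\<And>q z. z \<in> S \<Longrightarrow> (D q has_field_derivative r q * D (Suc q) z) (at z)"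
    and zero: "\<And>q. D q z0 = 0"
  shows "D 0 t = 0"
proof -
  have hol: "D q holomorphic_on S" for q
    using deriv S(1) by (auto simp: holomorphic_on_open)
  have "(deriv ^^ n) (D q) z = (\<Prod>i<n. r (q + i)) * D (q + n) z" if "z \<in> S" for n q z
    using that
  proof (induction n arbitrary: q z)
    case (Suc n)
    have "(deriv ^^ Suc n) (D q) z = (deriv ^^ n) (deriv (D q)) z"
      by (simp add: funpow_swap1)
    also have "\<dots> = (deriv ^^ n) (\<lambda>z. r q * D (Suc q) z) z"
      using hol S(1) deriv Suc.prems
      by (intro higher_deriv_transform_within_open[where S = S])
         (auto intro!: holomorphic_intros holomorphic_deriv DERIV_imp_deriv)
    also have "\<dots> = r q * (deriv ^^ n) (D (Suc q)) z"
      using hol S(1) Suc.prems by (intro higher_deriv_cmult) auto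
    also have "\<dots> = (\<Prod>i<Suc n. r (q + i)) * D (q + Suc n) z"
      by (simp add: Suc prod.lessThan_Suc_shift del: prod.lessThan_Suc)
    finally show ?case .
  qed auto
  then have "(deriv ^^ n) (D 0) z0 = 0" for n
    using zero S(3) by simp
  then show ?thesis
    using holomorphic_fun_eq_0_on_connected[OF hol S(1,2)] S(3,4) by blast
qed

text \<open>
  The points closer to \<open>x\<close> than to \<open>1\<close> form a half-plane. This makes the domain of the
  transformation convex.
\<close>
lemma norm_1_minus_less_iff:
  fixes x t :: complex
  shows "norm (x - t) < norm (1 - t) \<longleftrightarrow> (2 * (1 - x)) \<bullet> t < 1 - (norm x)\<^sup>2"
proof -
  have "norm (x - t) < norm (1 - t) \<longleftrightarrow> (norm (x - t))\<^sup>2 < (norm (1 - t))\<^sup>2"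
    by (simp add: power_mono_iff linorder_not_le[symmetric])
  then show ?thesis
    unfolding cmod_power2 by (simp add: inner_complex_def power2_eq_square algebra_simps)
qed

lemma Re_1_minus_pos: "norm (t :: complex) < 1 \<Longrightarrow> 0 < Re (1 - t)"
  using complex_Re_le_cmod[of t] by simp

lemma not_nonpos_Reals_1_minus: "norm (t :: complex) < 1 \<Longrightarrow> 1 - t \<notin> \<real>\<^sub>\<le>\<^sub>0"
  using Re_1_minus_pos[of t] by (auto simp: complex_nonpos_Reals_iff)

text \<open>
  With \<open>y = (x - t)/(1 - t)\<close> we have \<open>dy/dt = - (1 - y)/(1 - t)\<close>, so differentiating the product
  produces exactly the left side of \<open>appell_F1_contiguous\<close>.
\<close>
lemma moebius_appell_F1_has_field_derivative:
  assumes c: "c \<notin> \<int>\<^sub>\<le>\<^sub>0" and x: "norm x < 1" and t: "norm t < 1" "norm (x - t) < norm (1 - t)"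
  shows "((\<lambda>t. (1 - t) powr (- b') * appell_F1 a b b' c x ((x - t) / (1 - t))) has_field_derivative
     b' * (c - a) / c * ((1 - t) powr (- (b' + 1)) * appell_F1 a b (b' + 1) (c + 1) x ((x - t) / (1 - t)))) (at t)"
proof -
  define y where "y = (x - t) / (1 - t)"
  define D where "D = a * b' / c * appell_F1 (a + 1) b (b' + 1) (c + 1) x y"
  have nz: "1 - t \<noteq> 0" and pos: "1 - t \<notin> \<real>\<^sub>\<le>\<^sub>0"
    using t(1) not_nonpos_Reals_1_minus by auto
  have y: "norm y < 1"
    using t(2) nz by (simp add: y_def norm_divide)
  have F: "(appell_F1 a b b' c x has_field_derivative D) (at ((x - t) / (1 - t)))"
    using appell_F1_has_field_derivative[OF c x y] by (simp add: D_def y_def)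
  have dy: "((\<lambda>t. (x - t) / (1 - t)) has_field_derivative - (1 - y) / (1 - t)) (at t)"
    using nz by (auto intro!: derivative_eq_intros simp: y_def divide_simps)
  have dp: "((\<lambda>t. (1 - t) powr (- b')) has_field_derivative b' * (1 - t) powr (- (b' + 1))) (at t)"
    using pos by (auto intro!: derivative_eq_intros simp: minus_diff_commute)
  have split: "(1 - t) powr (- b') = (1 - t) powr (- (b' + 1)) * (1 - t)"
    using nz by (simp add: powr_diff[of _ "-b'" 1, simplified])
  show ?thesis
  proof (rule DERIV_cong[OF DERIV_mult[OF dp DERIV_chain2[OF F dy]]])
    have "b' * (1 - t) powr (- (b' + 1)) * appell_F1 a b b' c x y
        + D * (- (1 - y) / (1 - t)) * (1 - t) powr (- b')
      = (1 - t) powr (- (b' + 1)) * (b' * appell_F1 a b b' c x y - (1 - y) * D)"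
      unfolding split using nz by (simp add: field_simps)
    then show "b' * (1 - t) powr (- (b' + 1)) * appell_F1 a b b' c x ((x - t) / (1 - t))
        + D * (- (1 - y) / (1 - t)) * (1 - t) powr (- b')
      = b' * (c - a) / c * ((1 - t) powr (- (b' + 1)) * appell_F1 a b (b' + 1) (c + 1) x ((x - t) / (1 - t)))"
      unfolding y_def[symmetric] D_def appell_F1_contiguous[OF c x y] by simp
  qed
qed

text \<open>
  Both sides are functions of \<open>t\<close> whose derivatives are the same multiple of the functions with
  \<open>b'\<close> and \<open>c\<close> raised by one (on the right also \<open>c - a\<close> is raised). The hypothesis \<open>init\<close> is the
  equality of their values at \<open>t = 0\<close> for all shifted parameters. The constants \<open>C\<close> and \<open>d\<close> are
  left free because they are not affected by the shifts: \<open>x = 0\<close>, \<open>C = 1\<close> yields Pfaff's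
  transformation, and \<open>d = c - b - b'\<close> with a power of \<open>1 - x\<close> for \<open>C\<close> the one of Appell's function.
\<close>
lemma appell_F1_moebius:
  assumes c: "c \<notin> \<int>\<^sub>\<le>\<^sub>0" and x: "norm x < 1" and t: "norm t < 1" "norm (x - t) < norm (1 - t)"
    and init: "\<And>q. hyp2F1 a (b + (b' + of_nat q)) (c + of_nat q) x
                  = C * hyp2F1 (c - a + of_nat q) d (c + of_nat q) x"
  shows "(1 - t) powr (- b') * appell_F1 a b b' c x ((x - t) / (1 - t)) = C * appell_F1 (c - a) d b' c x t"
proof -
  define D where "D q t = (1 - t) powr (- (b' + of_nat q)) *
      appell_F1 a b (b' + of_nat q) (c + of_nat q) x ((x - t) / (1 - t))
      - C * appell_F1 (c - a + of_nat q) d (b' + of_nat q) (c + of_nat q) x t" for q :: nat and t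
  define r where "r q = (b' + of_nat q) * (c - a + of_nat q) / (c + of_nat q)" for q :: nat
  let ?S = "ball 0 1 \<inter> {t. (2 * (1 - x)) \<bullet> t < 1 - (norm x)\<^sup>2}"
  note c_q = notin_nonpos_Ints_add_of_nat[OF c]
  have "D 0 t = 0"
  proof (rule holomorphic_vanishes_of_derivative_chain[where S = ?S and r = r and D = D and ?z0.0 = 0])
    show "open ?S" "connected ?S"
      by (auto intro!: open_Int open_halfspace_lt convex_connected convex_Int convex_halfspace_lt)
    show "0 \<in> ?S" using x by (simp add: power_less_one_iff abs_square_less_1)
    show "t \<in> ?S" using t by (simp add: norm_1_minus_less_iff)
    show "D q 0 = 0" for q
      using init[of q] by (simp add: D_def appell_F1_diagonal[OF c_q x] appell_F1_y_0[OF c_q x])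
  next
    fix q z assume "z \<in> ?S"
    then have z: "norm z < 1" "norm (x - z) < norm (1 - z)" by (auto simp: norm_1_minus_less_iff)
    have "(D q has_field_derivative
      (b' + of_nat q) * (c + of_nat q - a) / (c + of_nat q) *
        ((1 - z) powr (- (b' + of_nat q + 1)) *
           appell_F1 a b (b' + of_nat q + 1) (c + of_nat q + 1) x ((x - z) / (1 - z)))
      - C * ((c - a + of_nat q) * (b' + of_nat q) / (c + of_nat q) *
           appell_F1 (c - a + of_nat q + 1) d (b' + of_nat q + 1) (c + of_nat q + 1) x z)) (at z)"
      unfolding D_def
      by (intro DERIV_diff DERIV_cmult moebius_appell_F1_has_field_derivative
            appell_F1_has_field_derivative c_q x z)
    then show "(D q has_field_derivative r q * D (Suc q) z) (at z)"
      by (rule DERIV_cong) (simp add: D_def r_def algebra_simps)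
  qed
  then show ?thesis by (simp add: D_def)
qed


section \<open>Pfaff's and Euler's transformations\<close>

lemma hyp2F1_pfaff:
  assumes c: "c \<notin> \<int>\<^sub>\<le>\<^sub>0" and t: "norm t < 1" "norm t < norm (1 - t)"
  shows "(1 - t) powr (- b) * hyp2F1 a b c (- t / (1 - t)) = hyp2F1 (c - a) b c t"
proof -
  have "norm (- t / (1 - t)) < 1"
    using t(2) by (simp add: norm_divide divide_less_eq_1)
  then show ?thesis
    using appell_F1_moebius[OF c, of 0 t a 0 b 1 0] t
    by (simp add: appell_F1_x_0[OF c])
qed

lemma hyp2F1_holomorphic:
  assumes "c \<notin> \<int>\<^sub>\<le>\<^sub>0"
  shows "hyp2F1 a b c holomorphic_on ball 0 1"
proof -
  have "appell_F1 a 0 b c 0 holomorphic_on ball 0 1"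
    unfolding holomorphic_on_open[OF open_ball]
    using appell_F1_has_field_derivative[OF assms, of 0] by fastforce
  then show ?thesis
    by (rule holomorphic_transform) (simp add: appell_F1_x_0[OF assms])
qed

text \<open>
  The map \<open>x \<mapsto> - x / (1 - x)\<close> is an involution that transforms \<open>1 - x\<close> into its inverse, so Pfaff's
  transformation applied to one numerator parameter and then to the other returns to \<open>x\<close>. Both
  applications are legitimate for \<open>\<bar>x\<bar> < 1/2\<close>.
\<close>
lemma hyp2F1_euler:
  assumes c: "c \<notin> \<int>\<^sub>\<le>\<^sub>0" and x: "norm x < 1"
  shows "hyp2F1 a b c x = (1 - x) powr (c - a - b) * hyp2F1 (c - a) (c - b) c x"
proof (rule analytic_continuation_open[of "ball 0 (1/2)" "ball 0 1"
        "hyp2F1 a b c" "\<lambda>x. (1 - x) powr (c - a - b) * hyp2F1 (c - a) (c - b) c x"])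
  fix x :: complex assume "x \<in> ball 0 (1/2)"
  then have x: "norm x < 1/2" by simp
  define z where "z = - x / (1 - x)"
  have lt: "norm x < norm (1 - x)"
    using x norm_triangle_ineq2[of 1 x] by simp
  have nz: "1 - x \<noteq> 0" using x by auto
  have z: "norm z < 1" using lt nz by (simp add: z_def norm_divide)
  have one_minus_z: "1 - z = inverse (1 - x)" using nz by (simp add: z_def field_simps)
  have z_lt: "norm z < norm (1 - z)"
    using x nz by (simp add: one_minus_z norm_inverse z_def norm_divide divide_simps)
  have pfaff_z: "- z / (1 - z) = x" using nz by (simp add: one_minus_z) (simp add: z_def)
  have "hyp2F1 a b c x = (1 - x) powr (- b) * hyp2F1 (c - a) b c z"
    using hyp2F1_pfaff[OF c _ lt, of b "c - a"] x by (simp add: z_def)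
  also have "hyp2F1 (c - a) b c z = hyp2F1 b (c - a) c z" by (rule hyp2F1_commute)
  also have "\<dots> = (1 - z) powr (- (c - a)) * hyp2F1 (c - b) (c - a) c x"
    using hyp2F1_pfaff[OF c z z_lt, of "c - a" "c - b"] unfolding pfaff_z by simp
  also have "(1 - z) powr (- (c - a)) = (1 - x) powr (c - a)"
    using not_nonpos_Reals_1_minus[of x] x nz
    by (simp add: one_minus_z powr_def Ln_inverse algebra_simps)
  finally show "hyp2F1 a b c x = (1 - x) powr (c - a - b) * hyp2F1 (c - a) (c - b) c x"
    by (simp add: hyp2F1_commute[of "c - b"] powr_add[symmetric] mult.assoc[symmetric])
qed (use x in \<open>auto intro!: holomorphic_intros hyp2F1_holomorphic c simp: not_nonpos_Reals_1_minus\<close>)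

section \<open>The transformation of the Appell function\<close>

lemma Ln_divide_Re_pos:
  assumes "0 < Re u" "0 < Re v"
  shows "Ln (u / v) = Ln u - Ln v"
proof -
  have [simp]: "u \<noteq> 0" "v \<noteq> 0" using assms by auto
  have "\<bar>Im (Ln u - Ln v)\<bar> < pi"
    using Re_Ln_pos_lt_imp[OF assms(1)] Re_Ln_pos_lt_imp[OF assms(2)]
    unfolding minus_complex.sel by linarith
  then have "Ln (exp (Ln u - Ln v)) = Ln u - Ln v" by (intro Ln_exp) auto
  then show ?thesis by (simp add: exp_diff)
qed

lemma appell_F1_euler:
  assumes c: "c \<notin> \<int>\<^sub>\<le>\<^sub>0" and x: "norm x < 1" and y: "norm y < 1"
    and xy: "norm ((y - x) / (1 - y)) < 1"
  shows "appell_F1 a b b' c x y = (1 - x) powr (c - a - b) * (1 - y) powr (- b') *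
           appell_F1 (c - a) (c - b - b') b' c x (- ((y - x) / (1 - y)))"
proof -
  define t where "t = - ((y - x) / (1 - y))"
  have nz: "1 - x \<noteq> 0" "1 - y \<noteq> 0" using x y by auto
  have one_minus_t: "1 - t = (1 - x) / (1 - y)" using nz by (simp add: t_def field_simps)
  have x_minus_t: "x - t = y * (1 - t)" using nz unfolding one_minus_t by (simp add: t_def field_simps)
  have t: "norm t < 1" using xy by (simp only: t_def norm_minus_cancel)
  have "norm (1 - t) > 0" using nz by (simp add: one_minus_t)
  then have xt: "norm (x - t) < norm (1 - t)" using y by (simp add: x_minus_t norm_mult)
  have "(1 - t) powr (- b') * appell_F1 a b b' c x ((x - t) / (1 - t)) =
    (1 - x) powr (c - a - b - b') * appell_F1 (c - a) (c - b - b') b' c x t"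
  proof (rule appell_F1_moebius[OF c x t xt])
    fix q
    from hyp2F1_euler[OF notin_nonpos_Ints_add_of_nat[OF c] x, of a "b + (b' + of_nat q)"]
    show "hyp2F1 a (b + (b' + of_nat q)) (c + of_nat q) x = (1 - x) powr (c - a - b - b') *
        hyp2F1 (c - a + of_nat q) (c - b - b') (c + of_nat q) x"
      by (simp add: algebra_simps)
  qed
  moreover have "(x - t) / (1 - t) = y" using nz by (simp add: x_minus_t one_minus_t)
  moreover have "(1 - t) powr (- b') = (1 - x) powr (- b') / (1 - y) powr (- b')"
    unfolding one_minus_t using nz
    by (simp add: powr_def Ln_divide_Re_pos Re_1_minus_pos x y exp_diff[symmetric] right_diff_distrib
         del: minus_complex.sel)
  moreover have "(1 - x) powr (c - a - b - b') = (1 - x) powr (c - a - b) * (1 - x) powr (- b')"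
    by (simp add: powr_add[symmetric])
  ultimately have "(1 - x) powr (- b') * appell_F1 a b b' c x y = (1 - x) powr (- b') *
      ((1 - x) powr (c - a - b) * (1 - y) powr (- b') * appell_F1 (c - a) (c - b - b') b' c x t)"
    using nz by (simp add: divide_simps mult_ac)
  moreover have "(1 - x) powr (- b') \<noteq> 0" using nz by simp
  ultimately show ?thesis by (simp add: t_def)
qed

theorem theorem11:
  fixes k :: real and \<alpha> \<beta> \<beta>' \<gamma> x y :: complex
  assumes "k > 0"
    and "\<And>j::nat. \<gamma> \<noteq> - (of_nat j * of_real k)"
    and "norm x < 1 / k" and "norm y < 1 / k"
  shows "(norm ((y - x) / (1 - of_real k * y)) < 1 / k \<longrightarrow>
            appell_F1_k k \<alpha> \<beta> \<beta>' \<gamma> x y =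
              (1 - of_real k * x) powr ((\<gamma> - \<alpha> - \<beta>) / of_real k)
              * (1 - of_real k * y) powr (- \<beta>' / of_real k)
              * appell_F1_k k (\<gamma> - \<alpha>) (\<gamma> - \<beta> - \<beta>') \<beta>' \<gamma> x (- ((y - x) / (1 - of_real k * y))))
       \<and> (norm ((y - x) / (1 - of_real k * x)) < 1 / k \<longrightarrow>
            appell_F1_k k \<alpha> \<beta> \<beta>' \<gamma> x y =
              (1 - of_real k * x) powr (- \<beta> / of_real k)
              * (1 - of_real k * y) powr ((\<gamma> - \<alpha> - \<beta>') / of_real k)
              * appell_F1_k k (\<gamma> - \<alpha>) \<beta> (\<gamma> - \<beta> - \<beta>') \<gamma> ((y - x) / (1 - of_real k * x)) y)"
proof -
  have c: "\<gamma> / of_real k \<notin> \<int>\<^sub>\<le>\<^sub>0"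
  proof
    assume "\<gamma> / of_real k \<in> \<int>\<^sub>\<le>\<^sub>0"
    then obtain j where "\<gamma> / of_real k = - of_nat j" by (elim nonpos_Ints_cases')
    with assms(1,2) show False by (simp add: field_simps)
  qed
  have swap: "appell_F1_k k a b b' \<gamma> u v = appell_F1_k k a b' b \<gamma> v u" for a b b' u v
    unfolding appell_F1_k_eq_appell_F1[OF assms(1)] by (rule appell_F1_commute)
  have transform: "appell_F1_k k a b b' \<gamma> u v =
      (1 - of_real k * u) powr ((\<gamma> - a - b) / of_real k) * (1 - of_real k * v) powr (- b' / of_real k)
      * appell_F1_k k (\<gamma> - a) (\<gamma> - b - b') b' \<gamma> u (- ((v - u) / (1 - of_real k * v)))"
    if "norm u < 1 / k" "norm v < 1 / k" "norm ((v - u) / (1 - of_real k * v)) < 1 / k" for a b b' u v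
  proof -
    have scale: "(of_real k * v - of_real k * u) / (1 - of_real k * v) =
        of_real k * ((v - u) / (1 - of_real k * v))"
      by (simp add: right_diff_distrib)
    have "norm (of_real k * w) < 1" if "norm w < 1 / k" for w :: complex
      using that assms(1) by (simp add: norm_mult field_simps)
    with that have "norm (of_real k * u) < 1" "norm (of_real k * v) < 1"
      "norm ((of_real k * v - of_real k * u) / (1 - of_real k * v)) < 1"
      unfolding scale by blast+
    from appell_F1_euler[OF c this, of "a / of_real k" "b / of_real k" "b' / of_real k"] show ?thesis
      unfolding appell_F1_k_eq_appell_F1[OF assms(1)] scale by (simp add: diff_divide_distrib[where c = "of_real k"])
  qed
  show ?thesis
  proof (intro conjI impI)
    assume "norm ((y - x) / (1 - of_real k * y)) < 1 / k"
    then show "appell_F1_k k \<alpha> \<beta> \<beta>' \<gamma> x y =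
        (1 - of_real k * x) powr ((\<gamma> - \<alpha> - \<beta>) / of_real k) * (1 - of_real k * y) powr (- \<beta>' / of_real k)
        * appell_F1_k k (\<gamma> - \<alpha>) (\<gamma> - \<beta> - \<beta>') \<beta>' \<gamma> x (- ((y - x) / (1 - of_real k * y)))"
      using assms by (intro transform)
  next
    assume "norm ((y - x) / (1 - of_real k * x)) < 1 / k"
    then have "norm ((x - y) / (1 - of_real k * x)) < 1 / k"
      by (simp add: norm_divide norm_minus_commute)
    moreover have "(y - x) / (1 - of_real k * x) = - ((x - y) / (1 - of_real k * x))"
      by (metis minus_diff_eq minus_divide_left)
    moreover have "\<gamma> - \<beta> - \<beta>' = \<gamma> - \<beta>' - \<beta>" by simp
    ultimately show "appell_F1_k k \<alpha> \<beta> \<beta>' \<gamma> x y =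
        (1 - of_real k * x) powr (- \<beta> / of_real k) * (1 - of_real k * y) powr ((\<gamma> - \<alpha> - \<beta>') / of_real k)
        * appell_F1_k k (\<gamma> - \<alpha>) \<beta> (\<gamma> - \<beta> - \<beta>') \<gamma> ((y - x) / (1 - of_real k * x)) y"
      unfolding swap[of \<alpha> \<beta> \<beta>'] swap[of "\<gamma> - \<alpha>" \<beta>]
      using transform[of y x \<alpha> \<beta>' \<beta>] assms(3,4) by (simp only: mult.commute)
  qed
qed

end
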